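(* Consider the multiple change point model of the context, satisfying conditions (M1)–(M4) stated there, and suppose the first stage estimators satisfy the first-stage consistency property stated there. Let $\hat\tau^{(2)}_k$ be the second stage intelligent sampling estimators. Then for every $\varepsilon>0$ there exist constants $C_1$ and $C_2$ (depending on $\varepsilon$) such that $$\mathbb P\Big[\hat J=J,\ \max_{k=1,\dots,J}|\hat\tau^{(2)}_k-\tau_k|\le C_1\log(J)+C_2\Big]\ge 1-\varepsilon$$ for all sufficiently large $N$.
   Context: Model. For each $N$ one observes $Y_i=\theta_i+\varepsilon_i$, $i=1,\dots,N$ (a triangular array; dependence on $N$ is suppressed). There are change points $1=\tau_0<\tau_1<\dots<\tau_J<\tau_{J+1}=N$, with $J=J(N)\ge1$, and levels $\nu_0,\dots,\nu_J$ with $\theta_i=\nu_j$ for $\tau_j<i\le\tau_{j+1}$ (and $\theta_1=\nu_0$). Conditions: (M1) $\max_i|\theta_i|\le\bar\theta$ for a constant $\bar\theta\in(0,\infty)$ not depending on $N$. (M2) $\min_{1\le j\le J}|\nu_j-\nu_{j-1}|\ge\underline\Delta$ for a constant $\underline\Delta>0$ not depending on $N$. (M3) There are $\Xi\in[0,1)$ and $C>0$ with $\delta_N:=\min_{0\le i\le J}(\tau_{i+1}-\tau_i)\ge CN^{1-\Xi}$ for all large $N$. (M4) $\varepsilon_1,\dots,\varepsilon_N$ are independent, centered and subgaussian with subgaussian parameters bounded by a constant $\sigma_{\max}>0$ not depending on $N$ (i.e. $\mathbb E e^{s\varepsilon_i}\le e^{s^2\sigma_{\max}^2/2}$ for all real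 $s$). Intelligent sampling. Stage 1: let $N_1=K_1N^\gamma$ with $K_1>0$, $\gamma\in(\Xi,1)$, $N/N_1=o(\delta_N)$. From the subsample $\{Y_i: i \text{ a multiple of }\lfloor N/N_1\rfloor\}$ only, some procedure produces estimators $\hat J$ of $J$, $\hat\tau^{(1)}_1,\dots,\hat\tau^{(1)}_{\hat J}$ of the change points, and $\hat\nu^{(1)}_0,\dots,\hat\nu^{(1)}_{\hat J}$ of the levels. First-stage consistency property: $$\mathbb P\Big[\hat J=J,\ \max_{1\le i\le J}|\hat\tau^{(1)}_i-\tau_i|\le w(N),\ \max_{0\le i\le J}|\hat\nu^{(1)}_i-\nu_i|\le\rho_N\Big]\to1$$ for some sequences with $w(N)\to\infty$, $w(N)=o(\delta_N)$, $w(N)\ge cN^{1-\gamma}$ for some constant $c>0$, and $\rho_N\to0$. Stage 2: fix an integer $K>1$; let $S^{(2)}(\hat\tau^{(1)}_i)$ be the set of integers in $[\hat\tau^{(1)}_i-Kw(N),\hat\tau^{(1)}_i+Kw(N)]$ not divisible by $\lfloor N/N_1\rfloor$. For $i=1,\dots,\hat J$, $$\hat\tau^{(2)}_i=\arg\min_{d\in S^{(2)}(\hat\tau^{(1)}_i)}\ \sum_{j\in S^{(2)}(\hat\tau^{(1)}_i)}\big[Y_j-\hat\nu^{(1)}_{i-1}1(j\le d)-\hat\nu^{(1)}_i1(j>d)\big]^2 .$$ *)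

theory Defs
  imports "HOL-Probability.Probability" "HOL-Library.Landau_Symbols"
begin

text \<open>Integrability is required explicitly because the Bochner integral of a non-integrable
  function is 0, which would make the bound vacuous.\<close>

definition subgaussian :: "'a measure \<Rightarrow> ('a \<Rightarrow> real) \<Rightarrow> real \<Rightarrow> bool" where
  "subgaussian M X \<sigma> \<longleftrightarrow>
     (\<forall>s::real. integrable M (\<lambda>\<omega>. exp (s * X \<omega>)) \<and>
        (\<integral>\<omega>. exp (s * X \<omega>) \<partial>M) \<le> exp (s\<^sup>2 * \<sigma>\<^sup>2 / 2))"

definition min_spacing :: "(nat \<Rightarrow> nat) \<Rightarrow> nat \<Rightarrow> real" where
  "min_spacing \<tau> J = (MIN i\<in>{0..J}. real (\<tau> (i + 1)) - real (\<tau> i))"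

definition stage1_size :: "real \<Rightarrow> real \<Rightarrow> nat \<Rightarrow> real" where
  "stage1_size K\<^sub>1 \<gamma> N = K\<^sub>1 * real N powr \<gamma>"

definition stage1_step :: "real \<Rightarrow> real \<Rightarrow> nat \<Rightarrow> nat" where
  "stage1_step K\<^sub>1 \<gamma> N = nat \<lfloor>real N / stage1_size K\<^sub>1 \<gamma> N\<rfloor>"

definition stage1_indices :: "real \<Rightarrow> real \<Rightarrow> nat \<Rightarrow> nat set" where
  "stage1_indices K\<^sub>1 \<gamma> N = {i \<in> {1..N}. stage1_step K\<^sub>1 \<gamma> N dvd i}"

text \<open>The \<sigma>-algebra on the sample space generated by the variables \<open>Y i\<close>, \<open>i \<in> I\<close>. A statistic
  computed from these variables only is one that is measurable with respect to it.\<close>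

definition generated_by ::
  "'a measure \<Rightarrow> nat set \<Rightarrow> (nat \<Rightarrow> 'a \<Rightarrow> real) \<Rightarrow> 'a measure" where
  "generated_by M I Y =
     vimage_algebra (space M) (\<lambda>\<omega>. \<lambda>i\<in>I. Y i \<omega>) (\<Pi>\<^sub>M i\<in>I. (borel :: real measure))"

text \<open>Integers within distance \<open>h\<close> of \<open>t\<close> that are not multiples of \<open>q\<close>. They are confined to
  \<open>{1..N}\<close>, where observations exist; \<open>h\<close> stands for \<open>K w(N)\<close>.\<close>

definition stage2_window :: "nat \<Rightarrow> nat \<Rightarrow> real \<Rightarrow> real \<Rightarrow> nat set" where
  "stage2_window N q h t = {j \<in> {1..N}. real j \<in> {t - h..t + h} \<and> \<not> q dvd j}"

definition stage2_criterion ::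
  "nat set \<Rightarrow> (nat \<Rightarrow> real) \<Rightarrow> real \<Rightarrow> real \<Rightarrow> nat \<Rightarrow> real" where
  "stage2_criterion S y a b d =
     (\<Sum>j\<in>S. (y j - a * of_bool (j \<le> d) - b * of_bool (j > d))\<^sup>2)"

end

theory Submission
  imports Defs
begin

text \<open>Suppose the first stage succeeds. Passing from \<open>\<tau> N k\<close> to another index \<open>d\<close> of its window changes
  the second stage criterion by a sum over the non-multiples \<open>j\<close> between them; each summand is, after
  division by the estimated jump, at least half the jump size \<open>\<Delta>\<close> up to a noise term \<open>2 err N j\<close>.
  So \<open>d\<close> can only be a minimiser if the noise averages to at least \<open>\<Delta> / 4\<close> over this range. By
  Chernoff's bound this has a probability exponentially small in \<open>\<bar>d - \<tau> N k\<bar>\<close>, and a union bound over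
  all \<open>d\<close> with \<open>\<bar>d - \<tau> N k\<bar> > m\<close> and all \<open>k\<close> costs a factor \<open>J N\<close>, which \<open>m\<close> of order \<open>ln (J N)\<close>
  absorbs. The noise event does not involve the first stage, so no conditioning on it is needed.\<close>

section \<open>Tail bounds for sums of independent subgaussian variables\<close>

text \<open>Independence factorises the moment generating function of the sum, and Chernoff's
  inequality does the rest. The threshold grows with \<open>card A\<close> so that the bound decays
  exponentially in \<open>card A\<close>.\<close>

lemma (in prob_space) subgaussian_sum_upper_tail:
  fixes X :: "nat \<Rightarrow> 'a \<Rightarrow> real"
  assumes "finite A" and indep: "indep_vars (\<lambda>_. borel) X A"
    and sub: "\<And>i. i \<in> A \<Longrightarrow> subgaussian M (X i) \<sigma>"
    and "\<sigma> > 0" "t > 0"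
  shows "prob {\<omega> \<in> space M. real (card A) * t \<le> (\<Sum>i\<in>A. X i \<omega>)}
    \<le> exp (- real (card A) * (t\<^sup>2 / (2 * \<sigma>\<^sup>2)))"
proof -
  \<comment> \<open>This value minimises the exponent
    \<open>s\<^sup>2 * \<sigma>\<^sup>2 / 2 - s * t\<close> contributed by each summand.\<close>
  define s where "s = t / \<sigma>\<^sup>2"
  have s: "s > 0" using assms by (simp add: s_def)
  have int: "integrable M (\<lambda>\<omega>. exp (s * X i \<omega>))" if "i \<in> A" for i
    using sub[OF that] by (simp add: subgaussian_def)
  have ind: "indep_vars (\<lambda>_. borel) (\<lambda>i \<omega>. exp (s * X i \<omega>)) A"
    by (rule indep_vars_compose2[OF indep]) auto
  have exp_sum: "exp (s * (\<Sum>i\<in>A. X i \<omega>)) = (\<Prod>i\<in>A. exp (s * X i \<omega>))" for \<omega>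
    by (simp add: sum_distrib_left exp_sum \<open>finite A\<close>)
  have intA: "integrable M (\<lambda>\<omega>. exp (s * (\<Sum>i\<in>A. X i \<omega>)))"
    unfolding exp_sum by (rule indep_vars_integrable[OF \<open>finite A\<close> ind int])
  have "expectation (\<lambda>\<omega>. exp (s * (\<Sum>i\<in>A. X i \<omega>)))
      = (\<Prod>i\<in>A. expectation (\<lambda>\<omega>. exp (s * X i \<omega>)))"
    unfolding exp_sum by (rule indep_vars_lebesgue_integral[OF \<open>finite A\<close> ind int])
  also have "\<dots> \<le> (\<Prod>i\<in>A. exp (s\<^sup>2 * \<sigma>\<^sup>2 / 2))"
    using sub by (intro prod_mono) (auto simp: subgaussian_def intro!: integral_nonneg_AE)
  also have "\<dots> = exp (real (card A) * (s\<^sup>2 * \<sigma>\<^sup>2 / 2))"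
    by (simp flip: exp_of_nat_mult)
  finally have mgf: "expectation (\<lambda>\<omega>. exp (s * (\<Sum>i\<in>A. X i \<omega>)))
      \<le> exp (real (card A) * (s\<^sup>2 * \<sigma>\<^sup>2 / 2))" .
  have "prob {\<omega> \<in> space M. real (card A) * t \<le> (\<Sum>i\<in>A. X i \<omega>)}
      \<le> exp (- s * (real (card A) * t)) * (LINT \<omega>:space M|M. exp (s * (\<Sum>i\<in>A. X i \<omega>)))"
    using integrable_mult_indicator[OF sets.top intA]
    by (intro Chernoff_ineq_ge s) (simp_all add: set_integrable_def)
  also have "\<dots> \<le> exp (- s * (real (card A) * t)) * exp (real (card A) * (s\<^sup>2 * \<sigma>\<^sup>2 / 2))"
    using mgf by (simp add: set_integral_space[OF intA])
  also have "\<dots> = exp (- real (card A) * (t\<^sup>2 / (2 * \<sigma>\<^sup>2)))"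
    using \<open>\<sigma> > 0\<close> unfolding exp_add[symmetric] s_def
    by (simp add: field_simps power2_eq_square)
  finally show ?thesis .
qed

lemma subgaussian_uminus: "subgaussian M X \<sigma> \<Longrightarrow> subgaussian M (\<lambda>\<omega>. - X \<omega>) \<sigma>"
  unfolding subgaussian_def
proof (intro allI)
  fix s :: real
  assume "\<forall>s. integrable M (\<lambda>\<omega>. exp (s * X \<omega>)) \<and>
    (\<integral>\<omega>. exp (s * X \<omega>) \<partial>M) \<le> exp (s\<^sup>2 * \<sigma>\<^sup>2 / 2)"
  from spec[OF this, of "- s"]
  show "integrable M (\<lambda>\<omega>. exp (s * - X \<omega>)) \<and>
    (\<integral>\<omega>. exp (s * - X \<omega>) \<partial>M) \<le> exp (s\<^sup>2 * \<sigma>\<^sup>2 / 2)"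
    by simp
qed

lemma (in prob_space) subgaussian_sum_tail:
  fixes X :: "nat \<Rightarrow> 'a \<Rightarrow> real"
  assumes "finite A" and indep: "indep_vars (\<lambda>_. borel) X A"
    and sub: "\<And>i. i \<in> A \<Longrightarrow> subgaussian M (X i) \<sigma>"
    and "\<sigma> > 0" "t > 0"
  shows "prob {\<omega> \<in> space M. real (card A) * t \<le> \<bar>\<Sum>i\<in>A. X i \<omega>\<bar>}
    \<le> 2 * exp (- real (card A) * (t\<^sup>2 / (2 * \<sigma>\<^sup>2)))"
proof -
  let ?U = "{\<omega> \<in> space M. real (card A) * t \<le> (\<Sum>i\<in>A. X i \<omega>)}"
  let ?L = "{\<omega> \<in> space M. real (card A) * t \<le> (\<Sum>i\<in>A. - X i \<omega>)}"
  have [measurable]: "X i \<in> borel_measurable M" if "i \<in> A" for i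
    using indep that by (auto simp: indep_vars_def)
  have ind': "indep_vars (\<lambda>_. borel) (\<lambda>i \<omega>. - X i \<omega>) A"
    by (rule indep_vars_compose2[OF indep]) auto
  have "?U \<in> events" "?L \<in> events" by measurable
  have "prob {\<omega> \<in> space M. real (card A) * t \<le> \<bar>\<Sum>i\<in>A. X i \<omega>\<bar>} \<le> prob (?U \<union> ?L)"
    using \<open>?U \<in> events\<close> \<open>?L \<in> events\<close>
    by (intro finite_measure_mono) (auto simp: sum_negf abs_if split: if_splits)
  also have "\<dots> \<le> prob ?U + prob ?L"
    using \<open>?U \<in> events\<close> \<open>?L \<in> events\<close> by (rule measure_Un_le)
  finally show ?thesis
    using subgaussian_sum_upper_tail[OF assms]
      subgaussian_sum_upper_tail[OF \<open>finite A\<close> ind' subgaussian_uminus[OF sub] \<open>\<sigma> > 0\<close> \<open>t > 0\<close>]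
    by simp
qed

section \<open>Counting non-multiples and summing geometric weights\<close>

text \<open>A split at \<open>d\<close> fits the left level to all \<open>j \<le> d\<close>, so
  moving it between \<open>s\<close> and \<open>t\<close>, in either direction, can refit only
  indices of this half-open range. Multiples of \<open>q\<close> are left out as in the second stage
  window.\<close>

definition nonmultiples_between :: "nat \<Rightarrow> nat \<Rightarrow> nat \<Rightarrow> nat set" where
  "nonmultiples_between q s t = {j \<in> {min s t<..max s t}. \<not> q dvd j}"

text \<open>Of two consecutive integers at most one is divisible by \<open>q\<close>, so every pair
  contributes a non-multiple; the \<open>+ 1\<close> covers an unpaired last integer.\<close>

lemma card_nonmultiples_interval:
  assumes "q \<ge> (2::nat)"
  shows "n \<le> 2 * card {j \<in> {a<..a + n}. \<not> q dvd j} + 1"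
proof (induction n rule: less_induct)
  case (less n)
  show ?case
  proof (cases "n \<le> 1")
    case False
    then obtain m where n: "n = m + 2"
      by (metis add.commute le_Suc_ex not_less_eq_eq numeral_2_eq_2 One_nat_def)
    have "\<not> (q dvd a + m + 1 \<and> q dvd a + m + 2)"
      using assms dvd_diff_nat[of q "a + m + 2" "a + m + 1"] by auto
    then obtain x where x: "x \<in> {a + m + 1, a + m + 2}" "\<not> q dvd x" by blast
    have "card (insert x {j \<in> {a<..a + m}. \<not> q dvd j}) \<le> card {j \<in> {a<..a + n}. \<not> q dvd j}"
      using x by (intro card_mono) (auto simp: n)
    moreover have "card (insert x {j \<in> {a<..a + m}. \<not> q dvd j})
        = Suc (card {j \<in> {a<..a + m}. \<not> q dvd j})"
      using x by (subst card_insert_disjoint) auto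
    ultimately show ?thesis using less[of m] by (simp add: n)
  qed simp
qed

text \<open>Injectivity makes the exponents distinct, so the sum is part of the geometric series
  started at \<open>m\<close>.\<close>

lemma sum_geometric_tail:
  fixes r :: real
  assumes "0 < r" "r < 1" "finite I" "inj_on f I" "\<And>i. i \<in> I \<Longrightarrow> m \<le> f i"
  shows "(\<Sum>i\<in>I. r ^ f i) \<le> r ^ m / (1 - r)"
proof -
  have sm: "summable (\<lambda>n. r ^ (n + m))"
    using assms by (intro summable_ignore_initial_segment summable_geometric) auto
  have "(\<Sum>i\<in>I. r ^ f i) = (\<Sum>i\<in>I. r ^ ((f i - m) + m))"
    using assms by (intro sum.cong) auto
  also have "\<dots> = (\<Sum>n\<in>(\<lambda>i. f i - m) ` I. r ^ (n + m))"
    using assms(4,5)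
    by (subst sum.reindex) (auto simp: inj_on_def, metis le_add_diff_inverse)
  also have "\<dots> \<le> (\<Sum>n. r ^ (n + m))"
    using assms by (intro sum_le_suminf sm) auto
  also have "\<dots> = r ^ m / (1 - r)"
    using assms by (simp add: power_add suminf_mult2[symmetric] suminf_geometric)
  finally show ?thesis .
qed

text \<open>On each side of \<open>t\<close> the distance determines \<open>d\<close>, whence the
  factor 2. The exponent is one below the distance because of the \<open>+ 1\<close> in
  \<open>card_nonmultiples_interval\<close>; it is still at least \<open>m\<close>.\<close>

lemma sum_geometric_outside:
  fixes r :: real
  assumes "0 < r" "r < 1"
  shows "(\<Sum>d | d \<in> {1..N} \<and> m < \<bar>int d - int t\<bar>. r ^ nat (\<bar>int d - int t\<bar> - 1))
    \<le> 2 * r ^ m / (1 - r)"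
proof -
  let ?f = "\<lambda>d. nat (\<bar>int d - int t\<bar> - 1)"
  let ?R = "{d \<in> {1..N}. int m < int d - int t}" and ?L = "{d \<in> {1..N}. int m < int t - int d}"
  have "{d. d \<in> {1..N} \<and> m < \<bar>int d - int t\<bar>} = ?R \<union> ?L" by auto
  then have "(\<Sum>d | d \<in> {1..N} \<and> m < \<bar>int d - int t\<bar>. r ^ ?f d)
      = (\<Sum>d\<in>?R. r ^ ?f d) + (\<Sum>d\<in>?L. r ^ ?f d)"
    by (simp only:) (rule sum.union_disjoint; auto)
  also have "\<dots> \<le> r ^ m / (1 - r) + r ^ m / (1 - r)"
    using assms by (intro add_mono sum_geometric_tail) (auto simp: inj_on_def)
  finally show ?thesis by simp
qed

section \<open>Deterministic analysis of the second stage criterion\<close>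

text \<open>Only indices between the two splits change their fitted level; all other summands
  cancel. Neither split has to lie in \<open>S\<close>, which matters when the change point is a
  multiple of \<open>q\<close>.\<close>

lemma criterion_diff_right:
  assumes "finite S" "t \<le> d"
  shows "stage2_criterion S y a b d - stage2_criterion S y a b t
    = (\<Sum>j\<in>{j\<in>S. t < j \<and> j \<le> d}. (y j - a)\<^sup>2 - (y j - b)\<^sup>2)"
  unfolding stage2_criterion_def sum_subtractf[symmetric]
  using assms by (intro sum.mono_neutral_cong_right) auto

lemma criterion_diff_left:
  assumes "finite S" "d \<le> t"
  shows "stage2_criterion S y a b d - stage2_criterion S y a b t
    = (\<Sum>j\<in>{j\<in>S. d < j \<and> j \<le> t}. (y j - b)\<^sup>2 - (y j - a)\<^sup>2)"
  unfolding stage2_criterion_def sum_subtractf[symmetric]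
  using assms by (intro sum.mono_neutral_cong_right) auto

text \<open>With \<open>g = p - p'\<close>, each summand equals \<open>g (g + 2 (l - p) + 2 e j)\<close>.\<close>

lemma misfit_gain_pos:
  fixes y e :: "nat \<Rightarrow> real"
  assumes y: "\<And>j. j \<in> A \<Longrightarrow> y j = l + e j"
    and noise: "\<bar>\<Sum>j\<in>A. e j\<bar> < real (card A) * (D / 4)"
    and p: "\<bar>p - l\<bar> \<le> D / 8" and p': "\<bar>p' - l'\<bar> \<le> D / 8" and gap: "D \<le> \<bar>l - l'\<bar>"
  shows "(\<Sum>j\<in>A. (y j - p')\<^sup>2 - (y j - p)\<^sup>2) > 0"
proof -
  define n g E where "n = real (card A)" and "g = p - p'" and "E = (\<Sum>j\<in>A. e j)"
  have "n \<ge> 0" by (simp add: n_def)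
  \<comment> \<open>Each of the two level estimates costs at most \<open>D / 8\<close> of the
    jump.\<close>
  have g: "3 / 4 * D \<le> \<bar>g\<bar>" using p p' gap unfolding g_def by linarith
  \<comment> \<open>A strict upper bound on an absolute value is positive, which excludes an empty
    \<open>A\<close> as well as \<open>D \<le> 0\<close>.\<close>
  have "n * D > 0" using noise by (simp add: n_def) 
  then have D: "D > 0" using \<open>n \<ge> 0\<close> by (simp add: zero_less_mult_iff)
  have "(\<Sum>j\<in>A. (y j - p')\<^sup>2 - (y j - p)\<^sup>2) = (\<Sum>j\<in>A. g * (g + 2 * (l - p)) + 2 * g * e j)"
    by (intro sum.cong refl) (simp add: y g_def power2_eq_square algebra_simps)
  also have "\<dots> = g * (n * (g + 2 * (l - p)) + 2 * E)"
    unfolding sum.distrib sum_distrib_left[symmetric] n_def E_def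
    by (simp add: algebra_simps)
  finally have eq: "(\<Sum>j\<in>A. (y j - p')\<^sup>2 - (y j - p)\<^sup>2) = g * (n * (g + 2 * (l - p)) + 2 * E)" .
  have E: "\<bar>E\<bar> < n * (D / 4)" using noise by (simp add: n_def E_def)
  show ?thesis
  proof (cases "g > 0")
    case True
    \<comment> \<open>The bias \<open>2 * (l - p)\<close> takes at most \<open>D / 4\<close> from
      \<open>3 / 4 * D\<close>. The remaining \<open>D / 2\<close> per index is exactly what twice
      the noise, below \<open>n * (D / 2)\<close>, cannot reach.\<close>
    then have "D / 2 \<le> g + 2 * (l - p)" using g abs_le_D1[OF p] by (simp add: field_simps)
    then have "n * (D / 2) \<le> n * (g + 2 * (l - p))"
      using \<open>n \<ge> 0\<close> by (rule mult_left_mono)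
    then show ?thesis unfolding eq using True E by (intro mult_pos_pos) linarith+
  next
    case False
    then have "g + 2 * (l - p) \<le> - (D / 2)" using g abs_le_D2[OF p] by (simp add: field_simps)
    then have "n * (g + 2 * (l - p)) \<le> n * (- (D / 2))"
      using \<open>n \<ge> 0\<close> by (rule mult_left_mono)
    then show ?thesis unfolding eq using False E g D by (intro mult_neg_neg) linarith+
  qed
qed

text \<open>This is applied to one fixed outcome. If \<open>d\<close> were farther than
  \<open>m\<close> from \<open>t\<close>, then \<open>misfit_gain_pos\<close> on the indices in
  between would make its criterion value strictly larger than that of \<open>t\<close>, against
  minimality.\<close>

lemma argmin_near_change_point:
  fixes y e :: "nat \<Rightarrow> real"
  assumes q: "q \<ge> (2::nat)" and t: "2 \<le> t" "t \<le> N"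
    and S: "S = stage2_window N q h t1"
    and win: "\<bar>t1 - real t\<bar> + 1 \<le> h"
    and y: "\<And>j. j \<in> S \<Longrightarrow> y j = (if j \<le> t then l else l') + e j"
    and noise: "\<And>d. d \<in> {1..N} \<Longrightarrow> m < \<bar>int d - int t\<bar> \<Longrightarrow>
      \<bar>\<Sum>j\<in>nonmultiples_between q d t. e j\<bar> < real (card (nonmultiples_between q d t)) * (D / 4)"
    and a: "\<bar>a - l\<bar> \<le> D / 8" and b: "\<bar>b - l'\<bar> \<le> D / 8" and gap: "D \<le> \<bar>l - l'\<bar>"
    and argmin: "S \<noteq> {} \<Longrightarrow> is_arg_min (stage2_criterion S y a b) (\<lambda>d. d \<in> S) d"
  shows "\<bar>int d - int t\<bar> \<le> m"
proof (rule ccontr)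
  assume far: "\<not> \<bar>int d - int t\<bar> \<le> m"
  let ?c = "stage2_criterion S y a b"
  have fin: "finite S" by (simp add: S stage2_window_def)
  have in_S: "j \<in> S \<longleftrightarrow> 1 \<le> j \<and> j \<le> N \<and> t1 - h \<le> real j \<and> real j \<le> t1 + h \<and> \<not> q dvd j" for j
    by (auto simp: S stage2_window_def)
  \<comment> \<open>The slack 1 in \<open>win\<close> keeps \<open>t - 1\<close> in range
    too.\<close>
  have t_win: "t1 - h \<le> real t - 1" "real t \<le> t1 + h" using win by linarith+
  text \<open>The change point itself may be a multiple of \<open>q\<close>, hence outside the window; then its left
    neighbour has the same criterion value.\<close>
  obtain s where s: "s \<in> S" "?c s = ?c t"
  proof (cases "q dvd t")
    case False
    then have "t \<in> S" using t t_win by (simp add: in_S)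
    then show ?thesis using that by blast
  next
    case True
    have nd: "\<not> q dvd t - 1"
    proof
      assume "q dvd t - 1"
      then have "q dvd t - (t - 1)" using True by (rule dvd_diff_nat[rotated])
      then show False using q t by simp
    qed
    have "t - 1 \<in> S" using nd t t_win by (auto simp: in_S of_nat_diff)
    moreover have "{j \<in> S. t - 1 < j \<and> j \<le> t} \<subseteq> {t}" "t \<notin> S"
      using True by (auto simp: in_S)
    then have "{j \<in> S. t - 1 < j \<and> j \<le> t} = {}" by blast
    then have "?c (t - 1) = ?c t"
      using criterion_diff_left[OF fin, of "t - 1" t y a b] by (simp only: sum.empty diff_le_self) simp
    ultimately show ?thesis using that by blast
  qed
  \<comment> \<open>The element \<open>s\<close> also shows that the window is nonempty, the premise
    of \<open>argmin\<close>.\<close>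
  have "d \<in> S" "\<not> ?c s < ?c d"
    using argmin s(1) unfolding is_arg_min_def by blast+
  then have d: "d \<in> S" "?c d \<le> ?c t" using s(2) by auto
  have dN: "d \<in> {1..N}" using d by (simp add: S stage2_window_def)
  let ?A = "nonmultiples_between q d t"
  have A: "\<bar>\<Sum>j\<in>?A. e j\<bar> < real (card ?A) * (D / 4)" using noise[OF dN] far by simp
  show False
  proof (cases "t \<le> d")
    case True
    \<comment> \<open>The window is an interval without the multiples of \<open>q\<close> and
      reaches both \<open>t\<close> and \<open>d\<close>. Hence the refitted indices no longer
      depend on the centre \<open>t1\<close>, and the noise bound applies to them.\<close>
    have eq: "{j \<in> S. t < j \<and> j \<le> d} = ?A"
    proof (rule set_eqI)
      fix j
      have "j \<in> S" if "t < j" "j \<le> d" "\<not> q dvd j"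
        using that d t_win dN by (simp add: in_S)
      then show "j \<in> {j \<in> S. t < j \<and> j \<le> d} \<longleftrightarrow> j \<in> ?A"
        using True by (auto simp: nonmultiples_between_def in_S)
    qed
    \<comment> \<open>To the right of \<open>t\<close> the true level is \<open>l'\<close>, so
      \<open>b\<close> is the correct fit and \<open>a\<close> the wrong one.\<close>
    have "(\<Sum>j\<in>?A. (y j - a)\<^sup>2 - (y j - b)\<^sup>2) > 0"
    proof (rule misfit_gain_pos[OF _ A b a])
      fix j assume "j \<in> ?A" then show "y j = l' + e j" using y[of j] unfolding eq[symmetric] by simp
    qed (use gap in simp)
    then show False using criterion_diff_right[OF fin True, of y a b] d unfolding eq by simp
  next
    case False
    then have le: "d \<le> t" by simp
    have eq: "{j \<in> S. d < j \<and> j \<le> t} = ?A"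
    proof (rule set_eqI)
      fix j
      have "j \<in> S" if "d < j" "j \<le> t" "\<not> q dvd j"
        using that d t t_win by (simp add: in_S)
      then show "j \<in> {j \<in> S. d < j \<and> j \<le> t} \<longleftrightarrow> j \<in> ?A"
        using False by (auto simp: nonmultiples_between_def in_S)
    qed
    have "(\<Sum>j\<in>?A. (y j - b)\<^sup>2 - (y j - a)\<^sup>2) > 0"
    proof (rule misfit_gain_pos[OF _ A a b])
      fix j assume "j \<in> ?A" then show "y j = l + e j" using y[of j] unfolding eq[symmetric] by simp
    qed (use gap in simp)
    then show False using criterion_diff_left[OF fin le, of y a b] d unfolding eq by simp
  qed
qed

section \<open>Probability of large noise and choice of the radius\<close>

text \<open>The rate in \<open>r\<close> is half the Chernoff rate
  \<open>x\<^sup>2 / (2 * \<sigma>\<^sup>2)\<close>, since up to rounding only half of the indices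
  in a range are sure to be non-multiples. The factor 4 counts two signs of the noise and two sides
  of \<open>T k\<close>.\<close>

lemma (in prob_space) noise_union_bound:
  fixes X :: "nat \<Rightarrow> 'a \<Rightarrow> real" and T :: "nat \<Rightarrow> nat" and m :: nat
  assumes indep: "indep_vars (\<lambda>_. borel) X {1..N}"
    and sub: "\<And>i. i \<in> {1..N} \<Longrightarrow> subgaussian M (X i) \<sigma>"
    and "\<sigma> > 0" "x > 0" "q \<ge> 2" and T: "\<And>k. k \<in> {1..J} \<Longrightarrow> T k \<le> N"
    and r: "r = exp (- x\<^sup>2 / (4 * \<sigma>\<^sup>2))"
  defines "B \<equiv> {\<omega> \<in> space M. \<exists>k\<in>{1..J}. \<exists>d\<in>{1..N}. int m < \<bar>int d - int (T k)\<bar> \<and>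
    real (card (nonmultiples_between q d (T k))) * x \<le> \<bar>\<Sum>j\<in>nonmultiples_between q d (T k). X j \<omega>\<bar>}"
  shows "B \<in> events" "prob B \<le> real J * (4 * r ^ m / (1 - r))"
proof -
  let ?A = "\<lambda>d k. nonmultiples_between q d (T k)"
  let ?I = "\<lambda>k. {d. d \<in> {1..N} \<and> int m < \<bar>int d - int (T k)\<bar>}"
  let ?B = "\<lambda>k d. {\<omega> \<in> space M. real (card (?A d k)) * x \<le> \<bar>\<Sum>j\<in>?A d k. X j \<omega>\<bar>}"
  have r01: "0 < r" "r < 1" using assms by (auto simp: r)
  have [measurable]: "X i \<in> borel_measurable M" if "i \<in> {1..N}" for i
    using indep that by (auto simp: indep_vars_def)
  have A: "?A d k \<subseteq> {1..N}" if "k \<in> {1..J}" "d \<in> ?I k" for k d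
    using that T[OF that(1)] by (auto simp: nonmultiples_between_def)
  have Bm: "?B k d \<in> events" if "k \<in> {1..J}" "d \<in> ?I k" for k d
  proof -
    have [measurable]: "(\<lambda>\<omega>. \<Sum>j\<in>?A d k. X j \<omega>) \<in> borel_measurable M"
      using A[OF that] by (intro borel_measurable_sum) auto
    show ?thesis by measurable
  qed
  have B: "B = (\<Union>k\<in>{1..J}. \<Union>d\<in>?I k. ?B k d)" unfolding B_def by blast
  show "B \<in> events" unfolding B using Bm by (intro sets.finite_UN) auto
  have single: "prob (?B k d) \<le> 2 * r ^ nat (\<bar>int d - int (T k)\<bar> - 1)"
    if kd: "k \<in> {1..J}" "d \<in> ?I k" for k d
  proof -
    let ?n = "nat (\<bar>int d - int (T k)\<bar> - 1)"
    have "?A d k = {j \<in> {min d (T k)<..min d (T k) + nat \<bar>int d - int (T k)\<bar>}. \<not> q dvd j}"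
      by (auto simp: nonmultiples_between_def)
    then have n: "real ?n \<le> 2 * real (card (?A d k))"
      using card_nonmultiples_interval[OF \<open>q \<ge> 2\<close>, of "nat \<bar>int d - int (T k)\<bar>" "min d (T k)"]
      by simp linarith
    have "prob (?B k d) \<le> 2 * exp (- real (card (?A d k)) * (x\<^sup>2 / (2 * \<sigma>\<^sup>2)))"
      using A[OF kd] assms(3,4) finite_subset[OF A[OF kd]]
      by (intro subgaussian_sum_tail indep_vars_subset[OF indep] sub) auto
    also have "\<dots> \<le> 2 * exp (- (real ?n / 2) * (x\<^sup>2 / (2 * \<sigma>\<^sup>2)))"
      using n by (intro mult_left_mono exp_mono mult_right_mono) auto
    also have "\<dots> = 2 * r ^ ?n"
      unfolding r exp_of_nat_mult[symmetric] by simp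
    finally show ?thesis .
  qed
  have "prob B \<le> (\<Sum>k\<in>{1..J}. prob (\<Union>d\<in>?I k. ?B k d))"
    unfolding B using Bm by (intro measure_UNION_le sets.finite_UN) auto
  also have "\<dots> \<le> (\<Sum>k\<in>{1..J}. \<Sum>d\<in>?I k. prob (?B k d))"
    using Bm by (intro sum_mono measure_UNION_le) auto
  also have "\<dots> \<le> (\<Sum>k\<in>{1..J}. 2 * (\<Sum>d\<in>?I k. r ^ nat (\<bar>int d - int (T k)\<bar> - 1)))"
    unfolding sum_distrib_left using single by (intro sum_mono) auto
  also have "\<dots> \<le> (\<Sum>k\<in>{1..J}. 2 * (2 * r ^ m / (1 - r)))"
    by (intro sum_mono mult_left_mono sum_geometric_outside r01) auto
  finally show "prob B \<le> real J * (4 * r ^ m / (1 - r))" by simp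
qed

text \<open>Taking logarithms, the requirement is
  \<open>m \<ge> (ln J - ln \<kappa>) / (- ln r)\<close>. The constants depend on \<open>r\<close>
  and \<open>\<kappa>\<close> but not on \<open>J\<close>.\<close>

lemma log_exponent_suffices:
  fixes r \<kappa> :: real
  assumes r: "0 < r" "r < 1" and \<kappa>: "\<kappa> > 0"
  obtains C\<^sub>1 C\<^sub>2 :: real where
    "\<And>J. J \<ge> (1::nat) \<Longrightarrow> \<exists>m::nat. real m \<le> C\<^sub>1 * ln (real J) + C\<^sub>2 \<and> real J * r ^ m \<le> \<kappa>"
proof -
  define a where "a = - ln r"
  have a: "a > 0" using r by (simp add: a_def)
  \<comment> \<open>The 1 pays for rounding down to an integer. The maximum keeps the bound
    nonnegative if \<open>\<kappa> > 1\<close>, so that \<open>nat\<close> does not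
    truncate.\<close>
  define C\<^sub>2 where "C\<^sub>2 = 1 + max 0 (- ln \<kappa> / a)"
  have "\<exists>m::nat. real m \<le> 1 / a * ln (real J) + C\<^sub>2 \<and> real J * r ^ m \<le> \<kappa>"
    if J: "J \<ge> (1::nat)" for J
  proof -
    define m where "m = nat \<lfloor>1 / a * ln (real J) + C\<^sub>2\<rfloor>"
    have nn: "0 \<le> 1 / a * ln (real J) + C\<^sub>2" using J a by (simp add: C\<^sub>2_def)
    have up: "real m \<le> 1 / a * ln (real J) + C\<^sub>2" using nn unfolding m_def by linarith
    have "1 / a * ln (real J) + (C\<^sub>2 - 1) \<le> real m" using nn unfolding m_def by linarith
    then have "1 / a * ln (real J) - ln \<kappa> / a \<le> real m" unfolding C\<^sub>2_def by linarith
    then have "ln (real J) - ln \<kappa> \<le> a * real m" using a by (simp add: field_simps)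
    then have "exp (ln (real J) - a * real m) \<le> exp (ln \<kappa>)" by simp
    moreover have "exp (ln (real J) - a * real m) = real J * r ^ m"
      using J r by (simp add: a_def exp_add exp_of_nat2_mult)
    ultimately have "real J * r ^ m \<le> \<kappa>" using \<kappa> by simp
    then show ?thesis using up by blast
  qed
  then show thesis by (rule that)
qed

section \<open>Measurability of first stage statistics and size of the sampling step\<close>

lemma measurable_generated_by:
  assumes "f \<in> generated_by M I Y \<rightarrow>\<^sub>M A" and "\<And>i. i \<in> I \<Longrightarrow> Y i \<in> borel_measurable M"
  shows "f \<in> M \<rightarrow>\<^sub>M A"
proof -
  have "(\<lambda>\<omega>. \<omega>) \<in> M \<rightarrow>\<^sub>M generated_by M I Y"
    unfolding generated_by_def using assms(2) by (intro measurable_vimage_algebra2) auto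
  from measurable_compose[OF this assms(1)] show ?thesis by simp
qed

text \<open>With step 1 every index would be a multiple and the windows would be empty. The ratio of
  \<open>N\<close> to the subsample size is \<open>N powr (1 - \<gamma>) / K\<^sub>1\<close>, which
  is unbounded as \<open>\<gamma> < 1\<close>.\<close>

lemma eventually_stage1_step_ge_2:
  assumes "K\<^sub>1 > 0" "\<gamma> < 1"
  shows "\<forall>\<^sub>F N in sequentially. stage1_step K\<^sub>1 \<gamma> N \<ge> 2"
proof -
  let ?b = "(2 * K\<^sub>1) powr (1 / (1 - \<gamma>))"
  have "\<forall>\<^sub>F N in sequentially. ?b \<le> real N"
    using filterlim_real_sequentially by (simp add: filterlim_at_top)
  then have "\<forall>\<^sub>F N in sequentially. real N powr (1 - \<gamma>) \<ge> 2 * K\<^sub>1"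
  proof eventually_elim
    case (elim N)
    then have "?b powr (1 - \<gamma>) \<le> real N powr (1 - \<gamma>)"
      using assms by (intro powr_mono2) auto
    then show ?case using assms by (simp add: powr_powr)
  qed
  then show ?thesis
    using eventually_gt_at_top[of 0]
  proof eventually_elim
    case (elim N)
    then have "2 \<le> real N / stage1_size K\<^sub>1 \<gamma> N"
      using assms by (simp add: stage1_size_def powr_diff field_simps)
    then show ?case unfolding stage1_step_def by linarith
  qed
qed

section \<open>Localisation of all change points in the second stage\<close>

theorem theorem3:
  fixes M :: "nat \<Rightarrow> 'a measure"
    and Y err :: "nat \<Rightarrow> nat \<Rightarrow> 'a \<Rightarrow> real"
    and \<theta> \<nu> :: "nat \<Rightarrow> nat \<Rightarrow> real"
    and J :: "nat \<Rightarrow> nat"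
    and \<tau> :: "nat \<Rightarrow> nat \<Rightarrow> nat"
    and J_hat :: "nat \<Rightarrow> 'a \<Rightarrow> nat"
    and \<tau>1_hat \<nu>1_hat :: "nat \<Rightarrow> nat \<Rightarrow> 'a \<Rightarrow> real"
    and \<tau>2_hat :: "nat \<Rightarrow> nat \<Rightarrow> 'a \<Rightarrow> nat"
    and w \<rho> :: "nat \<Rightarrow> real"
    and \<theta>_bar \<Delta> \<Xi> C \<sigma>_max K\<^sub>1 \<gamma> c :: real
    and K N0 :: nat
  assumes prob: "\<And>N. N \<ge> N0 \<Longrightarrow> prob_space (M N)"
    and obs: "\<And>N i \<omega>. N \<ge> N0 \<Longrightarrow> i \<in> {1..N} \<Longrightarrow> \<omega> \<in> space (M N) \<Longrightarrow>
          Y N i \<omega> = \<theta> N i + err N i \<omega>"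
    and J_pos: "\<And>N. N \<ge> N0 \<Longrightarrow> J N \<ge> 1"
    and \<tau>_first: "\<And>N. N \<ge> N0 \<Longrightarrow> \<tau> N 0 = 1"
    and \<tau>_last: "\<And>N. N \<ge> N0 \<Longrightarrow> \<tau> N (J N + 1) = N"
    and \<tau>_less: "\<And>N j. N \<ge> N0 \<Longrightarrow> j \<le> J N \<Longrightarrow> \<tau> N j < \<tau> N (j + 1)"
    and \<theta>_first: "\<And>N. N \<ge> N0 \<Longrightarrow> \<theta> N 1 = \<nu> N 0"
    and \<theta>_level: "\<And>N j i. N \<ge> N0 \<Longrightarrow> j \<le> J N \<Longrightarrow> \<tau> N j < i \<Longrightarrow> i \<le> \<tau> N (j + 1) \<Longrightarrow>
          \<theta> N i = \<nu> N j"
    and M1: "\<theta>_bar > 0"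
      "\<And>N. N \<ge> N0 \<Longrightarrow> (MAX i\<in>{1..N}. \<bar>\<theta> N i\<bar>) \<le> \<theta>_bar"
    and M2: "\<Delta> > 0"
      "\<And>N. N \<ge> N0 \<Longrightarrow> (MIN j\<in>{1..J N}. \<bar>\<nu> N j - \<nu> N (j - 1)\<bar>) \<ge> \<Delta>"
    and M3: "0 \<le> \<Xi>" "\<Xi> < 1" "C > 0"
      "\<forall>\<^sub>F N in sequentially. min_spacing (\<tau> N) (J N) \<ge> C * real N powr (1 - \<Xi>)"
    and M4: "\<sigma>_max > 0"
      "\<And>N. N \<ge> N0 \<Longrightarrow> prob_space.indep_vars (M N) (\<lambda>_. borel) (err N) {1..N}"
      "\<And>N i. N \<ge> N0 \<Longrightarrow> i \<in> {1..N} \<Longrightarrow>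
          integrable (M N) (err N i) \<and> (\<integral>\<omega>. err N i \<omega> \<partial>M N) = 0"
      "\<And>N i. N \<ge> N0 \<Longrightarrow> i \<in> {1..N} \<Longrightarrow> subgaussian (M N) (err N i) \<sigma>_max"
    and stage1_pars: "K\<^sub>1 > 0" "\<Xi> < \<gamma>" "\<gamma> < 1"
      "(\<lambda>N. real N / stage1_size K\<^sub>1 \<gamma> N) \<in> o(\<lambda>N. min_spacing (\<tau> N) (J N))"
    and stage1_estimators:
      "\<And>N. N \<ge> N0 \<Longrightarrow> J_hat N \<in>
          generated_by (M N) (stage1_indices K\<^sub>1 \<gamma> N) (Y N) \<rightarrow>\<^sub>M count_space UNIV"
      "\<And>N i. N \<ge> N0 \<Longrightarrow> \<tau>1_hat N i \<in>
          generated_by (M N) (stage1_indices K\<^sub>1 \<gamma> N) (Y N) \<rightarrow>\<^sub>M borel"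
      "\<And>N i. N \<ge> N0 \<Longrightarrow> \<nu>1_hat N i \<in>
          generated_by (M N) (stage1_indices K\<^sub>1 \<gamma> N) (Y N) \<rightarrow>\<^sub>M borel"
    and w: "filterlim w at_top sequentially"
      "w \<in> o(\<lambda>N. min_spacing (\<tau> N) (J N))"
      "c > 0" "\<forall>\<^sub>F N in sequentially. w N \<ge> c * real N powr (1 - \<gamma>)"
    and \<rho>: "\<rho> \<longlonglongrightarrow> 0"
    and stage1_consistency:
      "(\<lambda>N. measure (M N) {\<omega> \<in> space (M N). J_hat N \<omega> = J N \<and>
            (MAX i\<in>{1..J N}. \<bar>\<tau>1_hat N i \<omega> - real (\<tau> N i)\<bar>) \<le> w N \<and>
            (MAX i\<in>{0..J N}. \<bar>\<nu>1_hat N i \<omega> - \<nu> N i\<bar>) \<le> \<rho> N}) \<longlonglongrightarrow> 1"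
    and K: "K > 1"
    and stage2_measurable:
      "\<And>N k. N \<ge> N0 \<Longrightarrow> \<tau>2_hat N k \<in> M N \<rightarrow>\<^sub>M count_space UNIV"
    and stage2_argmin:
      "\<And>N k \<omega> S. N \<ge> N0 \<Longrightarrow> \<omega> \<in> space (M N) \<Longrightarrow> k \<in> {1..J_hat N \<omega>} \<Longrightarrow>
          S = stage2_window N (stage1_step K\<^sub>1 \<gamma> N) (real K * w N) (\<tau>1_hat N k \<omega>) \<Longrightarrow>
          S \<noteq> {} \<Longrightarrow>
          is_arg_min (stage2_criterion S (\<lambda>j. Y N j \<omega>) (\<nu>1_hat N (k - 1) \<omega>) (\<nu>1_hat N k \<omega>))
            (\<lambda>d. d \<in> S) (\<tau>2_hat N k \<omega>)"
  shows "\<forall>\<epsilon>>0. \<exists>C\<^sub>1 C\<^sub>2 :: real. \<forall>\<^sub>F N in sequentially.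
    measure (M N) {\<omega> \<in> space (M N). J_hat N \<omega> = J N \<and>
        (MAX k\<in>{1..J N}. \<bar>real (\<tau>2_hat N k \<omega>) - real (\<tau> N k)\<bar>) \<le> C\<^sub>1 * ln (real (J N)) + C\<^sub>2}
      \<ge> 1 - \<epsilon>"
proof (intro allI impI)
  fix \<epsilon> :: real assume \<epsilon>: "\<epsilon> > 0"
  \<comment> \<open>This is the ratio of \<open>noise_union_bound\<close> for
    \<open>x = \<Delta> / 4\<close>.\<close>
  define r where "r = exp (- (\<Delta> / 4)\<^sup>2 / (4 * \<sigma>_max\<^sup>2))"
  have r: "0 < r" "r < 1" using M2(1) M4(1) by (auto simp: r_def)
  \<comment> \<open>Chosen so that \<open>\<kappa> * (4 / (1 - r)) = \<epsilon> / 2\<close>.\<close>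
  define \<kappa> where "\<kappa> = \<epsilon> * (1 - r) / 8"
  have "\<kappa> > 0" using \<epsilon> r by (simp add: \<kappa>_def)
  from log_exponent_suffices[OF r this] obtain C\<^sub>1 C\<^sub>2 :: real where
    C12: "\<And>J. J \<ge> (1::nat) \<Longrightarrow> \<exists>m::nat. real m \<le> C\<^sub>1 * ln (real J) + C\<^sub>2 \<and> real J * r ^ m \<le> \<kappa>"
    by blast
  define G where "G N = {\<omega> \<in> space (M N). J_hat N \<omega> = J N \<and>
            (MAX i\<in>{1..J N}. \<bar>\<tau>1_hat N i \<omega> - real (\<tau> N i)\<bar>) \<le> w N \<and>
            (MAX i\<in>{0..J N}. \<bar>\<nu>1_hat N i \<omega> - \<nu> N i\<bar>) \<le> \<rho> N}" for N
  \<comment> \<open>The minimum with 1 keeps the lower bound nonnegative, so that \<open>G N\<close>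
    has positive measure even for large \<open>\<epsilon>\<close>.\<close>
  have ev_G: "\<forall>\<^sub>F N in sequentially. measure (M N) (G N) > 1 - min (\<epsilon> / 2) 1"
    using stage1_consistency \<epsilon> unfolding G_def by (intro order_tendstoD(1)) auto
  have ev_\<rho>: "\<forall>\<^sub>F N in sequentially. \<rho> N < \<Delta> / 8"
    using \<rho> M2(1) by (intro order_tendstoD(2)) auto
  have ev_w: "\<forall>\<^sub>F N in sequentially. w N \<ge> 1"
    using w(1) by (simp add: filterlim_at_top)
  \<comment> \<open>A window reaches \<open>K * w N\<close> from an estimate that is itself off by
    up to \<open>w N\<close>; one further \<open>w N\<close> makes the inequalities strict.\<close>
  have ev_sp: "\<forall>\<^sub>F N in sequentially. norm (w N) \<le> 1 / (K + 2) * norm (min_spacing (\<tau> N) (J N))"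
    by (rule landau_o.smallD[OF w(2)]) simp
  have "\<forall>\<^sub>F N in sequentially.
    measure (M N) {\<omega> \<in> space (M N). J_hat N \<omega> = J N \<and>
        (MAX k\<in>{1..J N}. \<bar>real (\<tau>2_hat N k \<omega>) - real (\<tau> N k)\<bar>) \<le> C\<^sub>1 * ln (real (J N)) + C\<^sub>2}
      \<ge> 1 - \<epsilon>"
    using ev_G ev_\<rho> ev_w ev_sp eventually_stage1_step_ge_2[OF stage1_pars(1,3)]
      eventually_ge_at_top[of N0]
  proof eventually_elim
    case (elim N)
    interpret prob_space "M N" using prob elim by blast
    let ?q = "stage1_step K\<^sub>1 \<gamma> N"
    let ?E = "{\<omega> \<in> space (M N). J_hat N \<omega> = J N \<and>
      (MAX k\<in>{1..J N}. \<bar>real (\<tau>2_hat N k \<omega>) - real (\<tau> N k)\<bar>) \<le> C\<^sub>1 * ln (real (J N)) + C\<^sub>2}"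
    have N: "N \<ge> N0" and q: "?q \<ge> 2" and w1: "w N \<ge> 1" using elim by auto
    have J: "J N \<ge> 1" using J_pos N by blast
    obtain m :: nat where m: "real m \<le> C\<^sub>1 * ln (real (J N)) + C\<^sub>2" "real (J N) * r ^ m \<le> \<kappa>"
      using C12[OF J] by blast
    have less: "\<tau> N j < \<tau> N (j + 1)" if "j \<le> J N" for j using \<tau>_less[OF N that] .
    have spacing: "(K + 2) * w N \<le> real (\<tau> N (i + 1)) - real (\<tau> N i)" if "i \<le> J N" for i
    proof -
      have "min_spacing (\<tau> N) (J N) > 0"
        unfolding min_spacing_def using less by (subst Min_gr_iff) auto
      then have "(K + 2) * w N \<le> min_spacing (\<tau> N) (J N)"
        using elim(4) w1 by (simp add: field_simps)
      also have "\<dots> \<le> real (\<tau> N (i + 1)) - real (\<tau> N i)"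
        unfolding min_spacing_def using that by (intro Min_le) auto
      finally show ?thesis .
    qed
    \<comment> \<open>For \<open>k \<ge> 1\<close> this gives \<open>2 \<le> \<tau> N k\<close>, so
      the left neighbour of a change point is still an observed index.\<close>
    have \<tau>_lower: "k + 1 \<le> \<tau> N k" if "k \<le> J N" for k
      using that
    proof (induction k)
      case 0 then show ?case using \<tau>_first[OF N] by simp
    next
      case (Suc k) then show ?case using less[of k] by simp
    qed
    have \<tau>_upper: "\<tau> N k \<le> N" if "k \<le> J N + 1" for k
      using that
    proof (induction k rule: inc_induct)
      case base then show ?case using \<tau>_last[OF N] by simp
    next
      case (step k) then show ?case using less[of k] by simp
    qed
    have gap: "\<Delta> \<le> \<bar>\<nu> N (k - 1) - \<nu> N k\<bar>" if "k \<in> {1..J N}" for k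
    proof -
      have "(MIN j\<in>{1..J N}. \<bar>\<nu> N j - \<nu> N (j - 1)\<bar>) \<le> \<bar>\<nu> N k - \<nu> N (k - 1)\<bar>"
        using that by (intro Min_le) auto
      then show ?thesis using M2(2)[OF N] by (simp add: abs_minus_commute)
    qed
    define B where "B = {\<omega> \<in> space (M N). \<exists>k\<in>{1..J N}. \<exists>d\<in>{1..N}. int m < \<bar>int d - int (\<tau> N k)\<bar> \<and>
      real (card (nonmultiples_between ?q d (\<tau> N k))) * (\<Delta> / 4)
        \<le> \<bar>\<Sum>j\<in>nonmultiples_between ?q d (\<tau> N k). err N j \<omega>\<bar>}"
    have B: "B \<in> events" "prob B \<le> real (J N) * (4 * r ^ m / (1 - r))"
      unfolding B_def
      by (rule noise_union_bound[OF M4(2)[OF N] M4(4)[OF N] M4(1) _ q _ r_def];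
          use M2(1) \<tau>_upper in simp)+
    have "real (J N) * (4 * r ^ m / (1 - r)) = real (J N) * r ^ m * (4 / (1 - r))" by simp
    also have "\<dots> \<le> \<kappa> * (4 / (1 - r))" using m(2) r by (intro mult_right_mono) auto
    also have "\<dots> = \<epsilon> / 2" using r by (simp add: \<kappa>_def field_simps)
    finally have B_small: "prob B \<le> \<epsilon> / 2" using B(2) by simp
    \<comment> \<open>A non-measurable set would have \<open>measure\<close> 0 by default, but the
      measure of \<open>G N\<close> is positive.\<close>
    have G_ev: "G N \<in> events" 
    proof (rule ccontr)
      assume "G N \<notin> events"
      then show False using elim(1) by (simp add: measure_notin_sets)
    qed
    have "Y N i \<in> borel_measurable (M N)" if "i \<in> stage1_indices K\<^sub>1 \<gamma> N" for i
    proof -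
      have i: "i \<in> {1..N}" using that by (auto simp: stage1_indices_def)
      then have [measurable]: "err N i \<in> borel_measurable (M N)" using M4(3)[OF N i] by auto
      have "(\<lambda>\<omega>. \<theta> N i + err N i \<omega>) \<in> borel_measurable (M N)" by measurable
      then show ?thesis using obs[OF N i] by (subst measurable_cong) auto
    qed
    from measurable_generated_by[OF stage1_estimators(1)[OF N] this]
    have [measurable]: "J_hat N \<in> M N \<rightarrow>\<^sub>M count_space UNIV" .
    \<comment> \<open>\<open>J N \<ge> 1\<close> makes the index ranges nonempty, without which
      \<open>Max\<close> is unspecified.\<close>
    have MAX_le: "(MAX k\<in>{1..J N}. f k) \<le> x \<longleftrightarrow> (\<forall>k\<in>{1..J N}. f k \<le> x)"
      "(MAX k\<in>{0..J N}. f k) \<le> x \<longleftrightarrow> (\<forall>k\<in>{0..J N}. f k \<le> x)" for f :: "nat \<Rightarrow> real" and x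
      using J by (auto simp: Max_le_iff)
    have E: "?E = {\<omega> \<in> space (M N). J_hat N \<omega> = J N \<and>
      (\<forall>k\<in>{1..J N}. \<bar>real (\<tau>2_hat N k \<omega>) - real (\<tau> N k)\<bar> \<le> C\<^sub>1 * ln (real (J N)) + C\<^sub>2)}"
      unfolding MAX_le ..
    have [measurable]: "\<tau>2_hat N k \<in> M N \<rightarrow>\<^sub>M count_space UNIV" for k
      using stage2_measurable[OF N] .
    have E_ev: "?E \<in> events" unfolding E by measurable
    have "G N - B \<subseteq> ?E"
    proof
      fix \<omega> assume \<omega>: "\<omega> \<in> G N - B"
      then have sp: "\<omega> \<in> space (M N)" and Jh: "J_hat N \<omega> = J N" by (auto simp: G_def)
      have \<tau>1: "\<bar>\<tau>1_hat N k \<omega> - real (\<tau> N k)\<bar> \<le> w N" if "k \<in> {1..J N}" for k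
        using \<omega> that unfolding G_def MAX_le by blast
      have \<nu>1: "\<bar>\<nu>1_hat N k \<omega> - \<nu> N k\<bar> \<le> \<Delta> / 8" if "k \<le> J N" for k
      proof -
        have "\<bar>\<nu>1_hat N k \<omega> - \<nu> N k\<bar> \<le> \<rho> N" using \<omega> that unfolding G_def MAX_le by simp
        then show ?thesis using elim(2) by simp
      qed
      have "\<bar>int (\<tau>2_hat N k \<omega>) - int (\<tau> N k)\<bar> \<le> int m" if k: "k \<in> {1..J N}" for k
      proof (rule argmin_near_change_point[OF q _ _ refl])
        let ?S = "stage2_window N ?q (real K * w N) (\<tau>1_hat N k \<omega>)"
        have k1: "k - 1 \<le> J N" "k \<le> J N" "k - 1 + 1 = k" using k by auto
        show "2 \<le> \<tau> N k" using \<tau>_lower[OF k1(2)] k by simp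
        show "\<tau> N k \<le> N" using \<tau>_upper k by simp
        \<comment> \<open>As \<open>K\<close> is an integer above 1, it is at least 2: one
          \<open>w N\<close> covers the first stage error, the other the slack 1.\<close>
        have "2 * w N \<le> real K * w N" using K w1 by (intro mult_right_mono) auto
        then show "\<bar>\<tau>1_hat N k \<omega> - real (\<tau> N k)\<bar> + 1 \<le> real K * w N"
          using \<tau>1[OF k] w1 by linarith
        show "Y N j \<omega> = (if j \<le> \<tau> N k then \<nu> N (k - 1) else \<nu> N k) + err N j \<omega>"
          if j: "j \<in> ?S" for j
        proof -
          have jN: "j \<in> {1..N}" and
            jw: "\<tau>1_hat N k \<omega> - real K * w N \<le> real j" "real j \<le> \<tau>1_hat N k \<omega> + real K * w N"
            using j by (auto simp: stage2_window_def)
          have near: "real (\<tau> N k) - (K + 1) * w N \<le> real j" "real j \<le> real (\<tau> N k) + (K + 1) * w N"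
            using jw \<tau>1[OF k] by (simp_all add: algebra_simps)
          \<comment> \<open>The window stays strictly within the spacing on both sides of
            \<open>\<tau> N k\<close>, so it meets only the two segments adjacent to this change
            point.\<close>
          have "(K + 1) * w N < (K + 2) * w N" using w1 by (simp add: distrib_right)
          then have hi: "j \<le> \<tau> N (k + 1)" and lo: "\<tau> N (k - 1) < j"
            using near spacing[OF k1(2)] spacing[OF k1(1)] unfolding k1(3) by linarith+
          have "\<theta> N j = \<nu> N (k - 1)" if "j \<le> \<tau> N k"
            using \<theta>_level[OF N k1(1) lo] that unfolding k1(3) .
          moreover have "\<theta> N j = \<nu> N k" if "\<tau> N k < j"
            using \<theta>_level[OF N k1(2) that hi] .
          ultimately show ?thesis using obs[OF N jN sp] by simp
        qed
        show "\<bar>\<Sum>j\<in>nonmultiples_between ?q d (\<tau> N k). err N j \<omega>\<bar>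
            < real (card (nonmultiples_between ?q d (\<tau> N k))) * (\<Delta> / 4)"
          if "d \<in> {1..N}" "int m < \<bar>int d - int (\<tau> N k)\<bar>" for d
          using \<omega> sp that k unfolding B_def by (auto simp: not_le)
        show "\<bar>\<nu>1_hat N (k - 1) \<omega> - \<nu> N (k - 1)\<bar> \<le> \<Delta> / 8" "\<bar>\<nu>1_hat N k \<omega> - \<nu> N k\<bar> \<le> \<Delta> / 8"
          using \<nu>1 k1 by auto
        show "\<Delta> \<le> \<bar>\<nu> N (k - 1) - \<nu> N k\<bar>" using gap k .
        show "is_arg_min (stage2_criterion ?S (\<lambda>j. Y N j \<omega>) (\<nu>1_hat N (k - 1) \<omega>) (\<nu>1_hat N k \<omega>))
            (\<lambda>d. d \<in> ?S) (\<tau>2_hat N k \<omega>)" if "?S \<noteq> {}"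
          using stage2_argmin[OF N sp _ refl that] k Jh by simp
      qed
      then have "\<bar>real (\<tau>2_hat N k \<omega>) - real (\<tau> N k)\<bar> \<le> C\<^sub>1 * ln (real (J N)) + C\<^sub>2"
        if "k \<in> {1..J N}" for k
        using that m(1) by force
      then show "\<omega> \<in> ?E" unfolding E using sp Jh by blast
    qed
    then have "prob (G N - B) \<le> prob ?E" using E_ev by (rule finite_measure_mono)
    \<comment> \<open>Leaving \<open>G N\<close> and entering \<open>B\<close> each cost at most
      \<open>\<epsilon> / 2\<close>.\<close>
    moreover have "prob (G N) \<le> prob (G N - B) + prob B"
      using G_ev B(1) measure_Un_le[of "G N - B" "M N" B] finite_measure_mono[of "G N" "G N - B \<union> B"]
      by auto
    ultimately show ?case using elim(1) B_small by simp
  qed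
  then show "\<exists>C\<^sub>1 C\<^sub>2 :: real. \<forall>\<^sub>F N in sequentially.
    measure (M N) {\<omega> \<in> space (M N). J_hat N \<omega> = J N \<and>
        (MAX k\<in>{1..J N}. \<bar>real (\<tau>2_hat N k \<omega>) - real (\<tau> N k)\<bar>) \<le> C\<^sub>1 * ln (real (J N)) + C\<^sub>2}
      \<ge> 1 - \<epsilon>" by blast
qed

end
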